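(* For all nonnegative integers $k,n$, $d_{k,n}=a_{k,n}$.
   Context: For nonnegative integers $k,n$, let $a_{k,n}$ be the number of ways to partition a set consisting of $k$ marked points on a line and $n$ marked points on a parallel line into pairs, joining the two points of each pair by a straight segment, such that no two segments have a common point (in particular, no endpoint lies on another segment). We have $a_{0,0}=1$. $d_{k,n}$ is the number of pairs $(T_1,T_2)$, where $T_1$ is a domino tiling of a $2\times k$ rectangle and $T_2$ is a domino tiling of a $2\times n$ rectangle, such that $T_1$ and $T_2$ contain the same number of vertical dominoes. A $2\times 0$ rectangle has exactly one (empty) tiling. *)

theory Defs
  imports "HOL-Analysis.Analysis" "HOL-Library.Disjoint_Sets"
begin

definition is_line :: "(real^2) set \<Rightarrow> bool" where
  "is_line L \<longleftrightarrow> affine L \<and> aff_dim L = 1"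

text \<open>The library's \<^const>\<open>affine_parallel\<close> is reflexive, so distinctness of the lines is
  required separately.\<close>

definition two_line_configuration ::
    "nat \<Rightarrow> nat \<Rightarrow> (real^2) set \<Rightarrow> (real^2) set \<Rightarrow> bool" where
  "two_line_configuration k n A B \<longleftrightarrow>
     (\<exists>L L'. is_line L \<and> is_line L' \<and> affine_parallel L L' \<and> L \<noteq> L' \<and> A \<subseteq> L \<and> B \<subseteq> L') \<and>
     finite A \<and> card A = k \<and> finite B \<and> card B = n"

lemma two_line_configuration_exists: "\<exists>A B. two_line_configuration k n A B"
proof -
  define L where "L r = {x::real^2. axis 2 1 \<bullet> x = r}" for r :: real
  define P where "P m r = (\<lambda>i::nat. vector [real i, r] :: real^2) ` {..<m}" for m r
  have line: "is_line (L r)" for r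
    unfolding is_line_def L_def by (simp add: affine_hyperplane aff_dim_hyperplane axis_eq_0_iff)
  have "L 1 = (\<lambda>x. axis 2 1 + x) ` L 0"
  proof (intro equalityI subsetI)
    fix x assume "x \<in> L 1"
    then have "x - axis 2 1 \<in> L 0"
      by (simp add: L_def inner_diff_right)
    then show "x \<in> (\<lambda>x. axis 2 1 + x) ` L 0"
      by (intro image_eqI[of _ _ "x - axis 2 1"]) auto
  qed (auto simp: L_def inner_add_right)
  then have par: "affine_parallel (L 0) (L 1)"
    unfolding affine_parallel_def by blast
  have on: "P m r \<subseteq> L r" for m r
    by (auto simp: P_def L_def inner_axis')
  have "axis 2 1 \<in> L 1" "axis 2 1 \<notin> L 0"
    by (auto simp: L_def)
  then have ne: "L 0 \<noteq> L 1" by blast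
  have "inj_on (\<lambda>i::nat. vector [real i, r] :: real^2) {..<m}" for m r
    by (auto simp: inj_on_def vec_eq_iff forall_2)
  then have card: "finite (P m r)" "card (P m r) = m" for m r
    by (simp_all add: P_def card_image)
  show ?thesis
    unfolding two_line_configuration_def using line par on ne card by meson
qed

definition pairings :: "'a set \<Rightarrow> 'a set set set" where
  "pairings S = {M. partition_on S M \<and> (\<forall>e\<in>M. card e = 2)}"

definition noncrossing :: "(real^2) set set \<Rightarrow> bool" where
  "noncrossing M \<longleftrightarrow>
     (\<forall>x y u v. {x, y} \<in> M \<longrightarrow> {u, v} \<in> M \<longrightarrow> {x, y} \<noteq> {u, v} \<longrightarrow>
        closed_segment x y \<inter> closed_segment u v = {})"

text \<open>When \<^prop>\<open>two_line_configuration k n A B\<close> holds, this is the number $a_{k,n}$; it is kept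
  as a function of the marked points, so that its independence of their position is not built in.\<close>

definition num_noncrossing_pairings :: "(real^2) set \<Rightarrow> (real^2) set \<Rightarrow> nat" where
  "num_noncrossing_pairings A B = card {M \<in> pairings (A \<union> B). noncrossing M}"

text \<open>Cells are pairs (row, column), with 2 rows and \<open>k\<close> columns; a vertical domino
  therefore fills a whole column.\<close>

definition rectangle :: "nat \<Rightarrow> (nat \<times> nat) set" where
  "rectangle k = {..<2} \<times> {..<k}"

definition horizontal_domino :: "(nat \<times> nat) set \<Rightarrow> bool" where
  "horizontal_domino D \<longleftrightarrow> (\<exists>i j. D = {(i, j), (i, j + 1)})"

definition vertical_domino :: "(nat \<times> nat) set \<Rightarrow> bool" where
  "vertical_domino D \<longleftrightarrow> (\<exists>i j. D = {(i, j), (i + 1, j)})"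

definition domino_tilings :: "nat \<Rightarrow> (nat \<times> nat) set set set" where
  "domino_tilings k =
     {T. partition_on (rectangle k) T \<and> (\<forall>D\<in>T. horizontal_domino D \<or> vertical_domino D)}"

definition num_vertical :: "(nat \<times> nat) set set \<Rightarrow> nat" where
  "num_vertical T = card {D \<in> T. vertical_domino D}"

definition d :: "nat \<Rightarrow> nat \<Rightarrow> nat" where
  "d k n = card {(T1, T2). T1 \<in> domino_tilings k \<and> T2 \<in> domino_tilings n \<and>
                           num_vertical T1 = num_vertical T2}"

end

theory Submission
  imports Defs
begin

text \<open>In a non-crossing pairing a segment inside one of the lines joins neighbouring points, since
  any point between its endpoints would lie on it, and the transversal segments join the remaining
  points of the two lines in increasing order. The pairing is therefore determined by the sets of
  left endpoints of the segments inside the lines, which can be any two sets of left endpoints of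
  disjoint neighbouring pairs that leave equally many points uncovered. In a domino tiling with two
  rows the horizontal dominoes of the rows lie above each other, so that a tiling is determined in
  the same way by one set of left endpoints, and the uncovered columns carry the vertical dominoes.
  A tiling is itself the special case of such a pairing in which both rows have the same
  length and the same left endpoints.\<close>

section \<open>Combinatorial models: start sets, ranks and layered pairings\<close>

definition adjacent_starts :: "nat \<Rightarrow> nat set set" where
  "adjacent_starts m = {S. \<forall>i\<in>S. Suc i < m \<and> Suc i \<notin> S}"

definition uncovered :: "nat \<Rightarrow> nat set \<Rightarrow> nat set" where
  "uncovered m S = {..<m} - (S \<union> Suc ` S)"

definition rank_in :: "nat set \<Rightarrow> nat \<Rightarrow> nat" where
  "rank_in U i = card (U \<inter> {..<i})"

text \<open>The lengths form a function of the row index, so that one statement covers either row; a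
  constant \<open>N\<close> gives the rectangle of a tiling.\<close>

definition two_rows :: "(nat \<Rightarrow> nat) \<Rightarrow> (nat \<times> nat) set" where
  "two_rows N = (SIGMA c:{..<2}. {..<N c})"

text \<open>What \<open>noncrossing\<close> becomes once the marked points of each line are numbered
  in order: the first condition keeps marked points off the segments inside a line, the second keeps
  transversals from meeting.\<close>

definition layered_pairings :: "(nat \<Rightarrow> nat) \<Rightarrow> (nat \<times> nat) set set set" where
  "layered_pairings N = {M \<in> pairings (two_rows N).
     (\<forall>c i j. {(c, i), (c, j)} \<in> M \<longrightarrow> i < j \<longrightarrow> j = Suc i) \<and>
     (\<forall>i j i' j'. {(0, i), (1, j)} \<in> M \<longrightarrow> {(0, i'), (1, j')} \<in> M \<longrightarrow> i < i' \<longrightarrow> j < j')}"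

definition row_starts :: "(nat \<times> nat) set set \<Rightarrow> nat \<Rightarrow> nat set" where
  "row_starts M c = {i. {(c, i), (c, Suc i)} \<in> M}"

text \<open>Matching by rank is the increasing bijection between the uncovered points of the two rows.\<close>

definition arrangement :: "(nat \<Rightarrow> nat) \<Rightarrow> (nat \<Rightarrow> nat set) \<Rightarrow> (nat \<times> nat) set set" where
  "arrangement N S =
     {{(c, i), (c, Suc i)} | c i. c < 2 \<and> i \<in> S c} \<union>
     {{(0, i), (1, j)} | i j. i \<in> uncovered (N 0) (S 0) \<and> j \<in> uncovered (N 1) (S 1) \<and>
        rank_in (uncovered (N 0) (S 0)) i = rank_in (uncovered (N 1) (S 1)) j}"

lemma finite_uncovered [simp]: "finite (uncovered m S)"
  by (simp add: uncovered_def)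

lemma adjacent_starts_subset: "S \<in> adjacent_starts m \<Longrightarrow> S \<subseteq> {..<m}"
  unfolding adjacent_starts_def using Suc_lessD by auto

section \<open>Ranks in finite sets of natural numbers\<close>

lemma rank_in_less:
  assumes "finite U" "i \<in> U" "i < j"
  shows "rank_in U i < rank_in U j"
  unfolding rank_in_def by (rule psubset_card_mono) (use assms in auto)

lemma rank_in_inj:
  assumes "finite U" "i \<in> U" "j \<in> U" "rank_in U i = rank_in U j"
  shows "i = j"
  using rank_in_less[OF assms(1,2), of j] rank_in_less[OF assms(1,3), of i] assms(4)
  by (cases i j rule: linorder_cases) auto

text \<open>The rank is injective on \<open>U\<close> with values below \<open>card U\<close>, so
  counting makes it onto.\<close>

lemma rank_in_image:
  assumes "finite U"
  shows "rank_in U ` U = {..<card U}"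
proof (rule card_subset_eq)
  show "rank_in U ` U \<subseteq> {..<card U}"
    unfolding rank_in_def using assms by (auto intro!: psubset_card_mono)
  have "inj_on (rank_in U) U"
    using rank_in_inj[OF assms] by (auto simp: inj_on_def)
  then show "card (rank_in U ` U) = card {..<card U}"
    by (simp add: card_image)
qed simp

lemma rank_in_exists:
  assumes "finite U" "finite V" "card U = card V" "i \<in> U"
  obtains j where "j \<in> V" "rank_in V j = rank_in U i"
proof -
  have "rank_in U i \<in> rank_in V ` V"
    using rank_in_image[OF assms(1)] rank_in_image[OF assms(2)] assms by auto
  then show ?thesis using that by force
qed

text \<open>The elements of \<open>V\<close> below \<open>f i\<close> are exactly the images of the
  elements of \<open>U\<close> below \<open>i\<close>. Hence an increasing bijection can only be the
  matching by rank.\<close>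

lemma strict_mono_bij_rank_in:
  assumes f: "bij_betw f U V" and mono: "\<And>i i'. i \<in> U \<Longrightarrow> i' \<in> U \<Longrightarrow> i < i' \<Longrightarrow> f i < f i'"
    and i: "i \<in> U"
  shows "rank_in V (f i) = rank_in U i"
proof -
  have less: "f i' < f i \<longleftrightarrow> i' < i" if "i' \<in> U" for i'
    using mono[OF that i] mono[OF i that] by (cases i i' rule: linorder_cases) auto
  have "V \<inter> {..<f i} = f ` (U \<inter> {..<i})"
    using less f by (auto simp: bij_betw_def)
  moreover have "inj_on f (U \<inter> {..<i})"
    using f by (auto simp: bij_betw_def inj_on_def)
  ultimately show ?thesis
    by (simp add: rank_in_def card_image)
qed

section \<open>Pairings and the partner of a point\<close>

lemma pairingsI:
  assumes "\<And>e. e \<in> M \<Longrightarrow> e \<subseteq> X \<and> card e = 2"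
    and "\<And>x. x \<in> X \<Longrightarrow> \<exists>e\<in>M. x \<in> e"
    and "\<And>e e' x. e \<in> M \<Longrightarrow> e' \<in> M \<Longrightarrow> x \<in> e \<Longrightarrow> x \<in> e' \<Longrightarrow> e = e'"
  shows "M \<in> pairings X"
proof -
  have "{} \<notin> M"
    using assms(1)[of "{}"] by auto
  then show ?thesis
    unfolding pairings_def partition_on_def disjoint_def using assms by blast
qed

lemma pairings_unique:
  assumes "M \<in> pairings X" "e \<in> M" "e' \<in> M" "x \<in> e" "x \<in> e'"
  shows "e = e'"
  using assms unfolding pairings_def partition_on_def disjoint_def by blast

lemma pairings_block:
  assumes "M \<in> pairings X" "e \<in> M"
  shows "e \<subseteq> X" "card e = 2"
  using assms unfolding pairings_def partition_on_def by auto

lemma pairings_partner: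
  assumes "M \<in> pairings X" "x \<in> X"
  obtains y where "{x, y} \<in> M" "y \<in> X" "y \<noteq> x"
proof -
  obtain e where e: "e \<in> M" "x \<in> e"
    using assms unfolding pairings_def partition_on_def by blast
  then obtain a b where "e = {a, b}" "a \<noteq> b"
    using pairings_block(2)[OF assms(1)] by (meson card_2_iff)
  then show ?thesis
    using that[of a] that[of b] e pairings_block(1)[OF assms(1) e(1)]
    by (auto simp: insert_commute)
qed

lemma pairings_partner_unique:
  assumes "M \<in> pairings X" "{x, y} \<in> M" "{x, z} \<in> M"
  shows "y = z"
  using pairings_unique[OF assms, of x] by (auto simp: doubleton_eq_iff)

section \<open>Layered pairings and their start sets\<close>

lemma adjacent_starts_row_starts:
  assumes M: "M \<in> pairings (two_rows N)"
  shows "row_starts M c \<in> adjacent_starts (N c)"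
  unfolding adjacent_starts_def
proof safe
  fix i assume "i \<in> row_starts M c"
  then have i: "{(c, i), (c, Suc i)} \<in> M" by (simp add: row_starts_def)
  then show "Suc i < N c"
    using pairings_block(1)[OF M] by (auto simp: two_rows_def)
  \<comment> \<open>Otherwise the point \<open>Suc i\<close> of row \<open>c\<close> would have two
    partners, \<open>i\<close> and \<open>Suc (Suc i)\<close>.\<close>
  assume "Suc i \<in> row_starts M c"
  then have "{(c, Suc i), (c, Suc (Suc i))} \<in> M" by (simp add: row_starts_def)
  then show False
    using pairings_partner_unique[OF M, of "(c, Suc i)" "(c, i)" "(c, Suc (Suc i))"] i
    by (simp add: insert_commute)
qed

text \<open>A partner in the same row is a neighbour, which makes the point a start or the successor
  of one. So an uncovered point is joined to the other row, which is \<open>1 - c\<close> for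
  \<open>c < 2\<close>; uniqueness of partners gives the converse.\<close>

lemma layered_cross_partner:
  assumes M: "M \<in> layered_pairings N" and c: "c < 2"
  shows "i \<in> uncovered (N c) (row_starts M c) \<longleftrightarrow> (\<exists>j. {(c, i), (1 - c, j)} \<in> M)"
proof
  have P: "M \<in> pairings (two_rows N)"
    and adj: "\<And>c i j. {(c, i), (c, j)} \<in> M \<Longrightarrow> i < j \<Longrightarrow> j = Suc i"
    using M unfolding layered_pairings_def by auto
  assume i: "i \<in> uncovered (N c) (row_starts M c)"
  then have "(c, i) \<in> two_rows N"
    using c by (auto simp: two_rows_def uncovered_def)
  then obtain c' j where y: "{(c, i), (c', j)} \<in> M" "(c', j) \<in> two_rows N" "(c', j) \<noteq> (c, i)"
    using pairings_partner[OF P] by (metis surj_pair)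
  show "\<exists>j. {(c, i), (1 - c, j)} \<in> M"
  proof (cases "c' = c")
    case True
    then have "i < j \<or> j < i" using y(3) by auto
    then have "j = Suc i \<or> i = Suc j"
      using adj[of c i j] adj[of c j i] y(1) True by (auto simp: insert_commute)
    then have "i \<in> row_starts M c \<union> Suc ` row_starts M c"
      using y(1) True by (auto simp: row_starts_def insert_commute)
    then show ?thesis using i by (auto simp: uncovered_def)
  next
    case False
    then have "c' = 1 - c" using c y(2) by (auto simp: two_rows_def)
    then show ?thesis using y(1) by blast
  qed
next
  have P: "M \<in> pairings (two_rows N)"
    using M unfolding layered_pairings_def by auto
  assume "\<exists>j. {(c, i), (1 - c, j)} \<in> M"
  then obtain j where j: "{(c, i), (1 - c, j)} \<in> M" ..
  have ne: "1 - c \<noteq> c" by presburger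
  have "i < N c"
    using pairings_block(1)[OF P j] by (auto simp: two_rows_def)
  moreover have "{(c, i), (c, i')} \<notin> M" for i'
    using pairings_partner_unique[OF P j, of "(c, i')"] ne by auto
  then have "{(c, i), (c, i')} \<notin> M \<and> {(c, i'), (c, i)} \<notin> M" for i'
    by (metis insert_commute)
  ultimately show "i \<in> uncovered (N c) (row_starts M c)"
    by (auto simp: uncovered_def row_starts_def)
qed

text \<open>Every uncovered point of either row has a partner across, and only one, so the
  transversals form a bijection; the second condition on layered pairings makes it
  increasing.\<close>

lemma layered_cross_matching:
  assumes M: "M \<in> layered_pairings N"
  defines "U \<equiv> \<lambda>c. uncovered (N c) (row_starts M c)"
  obtains f where "bij_betw f (U 0) (U 1)"
    "\<And>i i'. i \<in> U 0 \<Longrightarrow> i' \<in> U 0 \<Longrightarrow> i < i' \<Longrightarrow> f i < f i'"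
    "\<And>i j. {(0, i), (1, j)} \<in> M \<longleftrightarrow> i \<in> U 0 \<and> j = f i"
proof -
  have P: "M \<in> pairings (two_rows N)"
    and mono: "\<And>i j i' j'. {(0, i), (1, j)} \<in> M \<Longrightarrow> {(0, i'), (1, j')} \<in> M \<Longrightarrow> i < i' \<Longrightarrow> j < j'"
    using M unfolding layered_pairings_def by blast+
  have U0: "i \<in> U 0 \<longleftrightarrow> (\<exists>j. {(0, i), (1, j)} \<in> M)" for i
    using layered_cross_partner[OF M, of 0] by (simp add: U_def)
  have U1: "j \<in> U 1 \<longleftrightarrow> (\<exists>i. {(0, i), (1, j)} \<in> M)" for j
    using layered_cross_partner[OF M, of 1] by (simp add: U_def insert_commute)
  obtain f where f: "\<And>i. i \<in> U 0 \<Longrightarrow> {(0, i), (1, f i)} \<in> M"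
    using U0 by metis
  have iff: "{(0, i), (1, j)} \<in> M \<longleftrightarrow> i \<in> U 0 \<and> j = f i" for i j
    using f U0 pairings_partner_unique[OF P, of "(0, i)" "(1, j)" "(1, f i)"] by auto
  have "i = i'" if "i \<in> U 0" "i' \<in> U 0" "f i = f i'" for i i'
    using f[OF that(1)] f[OF that(2)] that(3)
      pairings_partner_unique[OF P, of "(1, f i)" "(0, i)" "(0, i')"] by (simp add: insert_commute)
  then have "bij_betw f (U 0) (U 1)"
    using U1 iff by (auto simp: bij_betw_def inj_on_def)
  then show ?thesis
    using that[OF _ _ iff] mono f by blast
qed

text \<open>The increasing bijection preserves ranks, so the transversals are the pairs of equal
  rank and \<open>M\<close> can be rebuilt from its starts. The same bijection forces equal numbers
  of uncovered points.\<close>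

lemma layered_arrangement:
  assumes M: "M \<in> layered_pairings N"
  shows "M = arrangement N (row_starts M)"
    and "card (uncovered (N 0) (row_starts M 0)) = card (uncovered (N 1) (row_starts M 1))"
proof -
  define U where "U = (\<lambda>c. uncovered (N c) (row_starts M c))"
  obtain f where f: "bij_betw f (U 0) (U 1)"
    and mono: "\<And>i i'. i \<in> U 0 \<Longrightarrow> i' \<in> U 0 \<Longrightarrow> i < i' \<Longrightarrow> f i < f i'"
    and iff: "\<And>i j. {(0, i), (1, j)} \<in> M \<longleftrightarrow> i \<in> U 0 \<and> j = f i"
    using layered_cross_matching[OF M] unfolding U_def by blast
  have rank: "rank_in (U 1) (f i) = rank_in (U 0) i" if "i \<in> U 0" for i
    using strict_mono_bij_rank_in[OF f mono that] .
  have f1: "f i \<in> U 1" if "i \<in> U 0" for i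
    using f that by (auto simp: bij_betw_def)
  have P: "M \<in> pairings (two_rows N)"
    and adj: "\<And>c i j. {(c, i), (c, j)} \<in> M \<Longrightarrow> i < j \<Longrightarrow> j = Suc i"
    using M unfolding layered_pairings_def by auto
  have cross: "{(0, i), (1, j)} \<in> M \<longleftrightarrow>
      i \<in> U 0 \<and> j \<in> U 1 \<and> rank_in (U 0) i = rank_in (U 1) j" for i j
    using iff rank f1 rank_in_inj[of "U 1" j "f i"] by (auto simp: U_def)
  \<comment> \<open>Written through membership in \<open>M\<close>, the arrangement is visibly
    contained in \<open>M\<close>; what remains is that every block has one of the two
    shapes.\<close>
  have arr: "arrangement N (row_starts M) =
     {{(c, i), (c, Suc i)} | c i. c < 2 \<and> {(c, i), (c, Suc i)} \<in> M} \<union>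
     {{(0, i), (1, j)} | i j. {(0, i), (1, j)} \<in> M}" (is "_ = ?H \<union> ?V")
    unfolding arrangement_def cross by (simp add: row_starts_def U_def)
  have "e \<in> ?H \<union> ?V" if e: "e \<in> M" for e
  proof -
    obtain x y where "e = {x, y}" "x \<noteq> y"
      using pairings_block(2)[OF P e] by (meson card_2_iff)
    then obtain c i c' j where xy: "e = {(c, i), (c', j)}" "(c, i) \<noteq> (c', j)"
      by (cases x, cases y) auto
    then have c: "c < 2" "c' < 2"
      using pairings_block(1)[OF P e] by (auto simp: two_rows_def)
    consider "c = c'" "i < j" | "c = c'" "j < i" | "c = 0" "c' = 1" | "c = 1" "c' = 0"
      using c xy(2) by (metis less_2_cases_iff linorder_neqE_nat One_nat_def)
    then show ?thesis
    proof cases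
      case 1
      then show ?thesis using adj[of c i j] e xy(1) c by auto
    next
      case 2
      then have "e = {(c, j), (c, i)}" using xy by auto
      then show ?thesis using adj[of c j i] 2 e c by auto
    next
      case 3
      then show ?thesis using e xy(1) by blast
    next
      case 4
      then have "e = {(0, j), (1, i)}" using xy by auto
      then show ?thesis using e by blast
    qed
  qed
  then show "M = arrangement N (row_starts M)"
    unfolding arr by blast
  show "card (uncovered (N 0) (row_starts M 0)) = card (uncovered (N 1) (row_starts M 1))"
    using bij_betw_same_card[OF f] by (simp add: U_def)
qed

text \<open>Equal counts give each uncovered point a partner of the same rank, so the blocks cover
  both rows. They are disjoint because ranks are injective and uncovered points avoid the pairs
  inside a row.\<close>

lemma arrangement_layered:
  assumes S: "\<And>c. c < 2 \<Longrightarrow> S c \<in> adjacent_starts (N c)"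
    and card: "card (uncovered (N 0) (S 0)) = card (uncovered (N 1) (S 1))"
  shows "arrangement N S \<in> layered_pairings N"
    and "\<And>c. c < 2 \<Longrightarrow> row_starts (arrangement N S) c = S c"
proof -
  let ?U = "\<lambda>c. uncovered (N c) (S c)"
  let ?M = "arrangement N S"
  \<comment> \<open>Blocks are unordered, so a pair may also be listed from its right end.\<close>
  have row: "{(c, i), (c, j)} \<in> ?M \<longleftrightarrow> c < 2 \<and> (i \<in> S c \<and> j = Suc i \<or> j \<in> S c \<and> i = Suc j)"
    for c i j
    unfolding arrangement_def by (auto simp: doubleton_eq_iff)
  have cross: "{(0, i), (1, j)} \<in> ?M \<longleftrightarrow> i \<in> ?U 0 \<and> j \<in> ?U 1 \<and> rank_in (?U 0) i = rank_in (?U 1) j"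
    for i j
    unfolding arrangement_def by (auto simp: doubleton_eq_iff)
  have Sd: "Suc i < N c" "Suc i \<notin> S c" if "i \<in> S c" "c < 2" for c i
    using S that unfolding adjacent_starts_def by auto
  have cases_M: "(\<exists>c i. e = {(c, i), (c, Suc i)} \<and> c < 2 \<and> i \<in> S c) \<or>
     (\<exists>i j. e = {(0, i), (1, j)} \<and> i \<in> ?U 0 \<and> j \<in> ?U 1 \<and> rank_in (?U 0) i = rank_in (?U 1) j)"
    if "e \<in> ?M" for e
    using that unfolding arrangement_def by blast
  have "?M \<in> pairings (two_rows N)"
  proof (rule pairingsI)
    fix e assume "e \<in> ?M"
    from cases_M[OF this] show "e \<subseteq> two_rows N \<and> card e = 2"
      by (auto simp: two_rows_def uncovered_def dest: Sd Suc_lessD)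
  next
    fix x assume "x \<in> two_rows N"
    then obtain c i where x: "x = (c, i)" and c: "c < 2" and i: "i < N c"
      by (auto simp: two_rows_def)
    consider "i \<in> S c" | i' where "i' \<in> S c" "i = Suc i'" | "i \<in> ?U c"
      using i by (auto simp: uncovered_def)
    then show "\<exists>e\<in>?M. x \<in> e"
    proof cases
      case 1
      then show ?thesis using row[of c i "Suc i"] x c by blast
    next
      case 2
      then show ?thesis using row[of c i' i] x c by blast
    next
      case 3
      consider "c = 0" | "c = 1" using c by linarith
      then show ?thesis
      proof cases
        case 1
        then show ?thesis
          using rank_in_exists[of "?U 0" "?U 1" i] card 3 cross x
          by (metis finite_uncovered insertCI)
      next
        case 2
        then show ?thesis
          using rank_in_exists[of "?U 1" "?U 0" i] card 3 cross x
          by (metis finite_uncovered insertCI)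
      qed
    qed
  next
    fix e e' x assume e: "e \<in> ?M" and e': "e' \<in> ?M" and x: "x \<in> e" "x \<in> e'"
    have rank_inj: "i = j" if "i \<in> ?U c" "j \<in> ?U c" "rank_in (?U c) i = rank_in (?U c) j" for c i j
      using rank_in_inj[OF finite_uncovered that] .
    have inj0: "i = j" if "i \<in> ?U 0" "j \<in> ?U 0" "rank_in (?U 0) i = rank_in (?U 0) j" for i j
      using rank_inj[OF that] .
    have inj1: "i = j" if "i \<in> ?U 1" "j \<in> ?U 1" "rank_in (?U 1) i = rank_in (?U 1) j" for i j
      using rank_inj[OF that] .
    have no: "i \<notin> S c" "i = Suc j \<Longrightarrow> j \<notin> S c" if "i \<in> ?U c" for c i j
      using that by (auto simp: uncovered_def)
    show "e = e'"
      using cases_M[OF e] cases_M[OF e']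
    proof (elim disjE exE conjE)
      fix c i c' i'
      assume "e = {(c, i), (c, Suc i)}" "c < 2" "i \<in> S c"
        "e' = {(c', i'), (c', Suc i')}" "c' < 2" "i' \<in> S c'"
      then show ?thesis using x by (auto dest: Sd)
    next
      fix c i i' j'
      assume "e = {(c, i), (c, Suc i)}" "c < 2" "i \<in> S c"
        "e' = {(0, i'), (1, j')}" "i' \<in> ?U 0" "j' \<in> ?U 1"
      then show ?thesis using x no by force
    next
      fix c i i' j'
      assume "e' = {(c, i), (c, Suc i)}" "c < 2" "i \<in> S c"
        "e = {(0, i'), (1, j')}" "i' \<in> ?U 0" "j' \<in> ?U 1"
      then show ?thesis using x no by force
    next
      fix i j i' j'
      assume a: "e = {(0, i), (1, j)}" "i \<in> ?U 0" "j \<in> ?U 1"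
          "rank_in (?U 0) i = rank_in (?U 1) j"
        "e' = {(0, i'), (1, j')}" "i' \<in> ?U 0" "j' \<in> ?U 1"
          "rank_in (?U 0) i' = rank_in (?U 1) j'"
      then have "i = i' \<or> j = j'" using x by auto
      then have "i = i' \<and> j = j'"
        using inj0[of i i'] inj1[of j j'] a by metis
      then show ?thesis using a by simp
    qed
  qed
  moreover have "j < j'"
    if "{(0, i), (1, j)} \<in> ?M" "{(0, i'), (1, j')} \<in> ?M" "i < i'" for i j i' j'
  proof -
    \<comment> \<open>The two ends of a transversal have equal rank, and ranks grow along a row, so
      the order in row 0 carries over to row 1.\<close>
    have "rank_in (?U 0) i < rank_in (?U 0) i'"
      using that cross by (intro rank_in_less) auto
    then have "rank_in (?U 1) j < rank_in (?U 1) j'"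
      using that(1,2) by (simp only: cross)
    then show ?thesis
      using rank_in_less[of "?U 1" j' j] that(2) cross by (cases j j' rule: linorder_cases) auto
  qed
  ultimately show "?M \<in> layered_pairings N"
    unfolding layered_pairings_def using row by force
  show "row_starts ?M c = S c" if "c < 2" for c
    using row that by (auto simp: row_starts_def)
qed

section \<open>Counting layered pairings by pairs of start sets\<close>

definition by_row :: "'a \<Rightarrow> 'a \<Rightarrow> nat \<Rightarrow> 'a" where
  "by_row a b = (\<lambda>c. if c = 0 then a else b)"

lemma by_row_simps [simp]: "by_row a b 0 = a" "by_row a b (Suc c) = b"
  by (simp_all add: by_row_def)

text \<open>The common parameter set: layered pairings and pairs of tilings are both put in
  bijection with it.\<close>

definition matched_starts :: "nat \<Rightarrow> nat \<Rightarrow> (nat set \<times> nat set) set" where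
  "matched_starts k n = {(S, S'). S \<in> adjacent_starts k \<and> S' \<in> adjacent_starts n \<and>
     card (uncovered k S) = card (uncovered n S')}"

text \<open>An arrangement consults only rows 0 and 1, while families such as
  \<open>row_starts M\<close> and \<open>by_row (row_starts M 0) (row_starts M 1)\<close> may differ
  at other indices.\<close>

lemma arrangement_cong:
  assumes "S 0 = S' 0" "S 1 = S' 1"
  shows "arrangement N S = arrangement N S'"
proof -
  have "S c = S' c" if "c < 2" for c
    using assms that by (auto simp: less_2_cases_iff)
  then have "c < 2 \<and> i \<in> S c \<longleftrightarrow> c < 2 \<and> i \<in> S' c" for c i
    by auto
  then show ?thesis
    unfolding arrangement_def assms by simp
qed

lemma card_layered_pairings:
  "card (layered_pairings (by_row k n)) = card (matched_starts k n)"
proof -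
  let ?N = "by_row k n"
  let ?f = "\<lambda>M. (row_starts M 0, row_starts M 1)"
  let ?g = "\<lambda>(S, S'). arrangement ?N (by_row S S')"
  have "bij_betw ?f (layered_pairings ?N) (matched_starts k n)"
  proof (rule bij_betw_byWitness[where f' = ?g])
    show "\<forall>M\<in>layered_pairings ?N. ?g (?f M) = M"
    proof
      fix M assume M: "M \<in> layered_pairings ?N"
      have "?g (?f M) = arrangement ?N (row_starts M)"
        by (simp, rule arrangement_cong) simp_all
      then show "?g (?f M) = M"
        using layered_arrangement(1)[OF M] by simp
    qed
    have "S \<in> adjacent_starts k \<Longrightarrow> S' \<in> adjacent_starts n \<Longrightarrow>
        c < 2 \<Longrightarrow> by_row S S' c \<in> adjacent_starts (?N c)" for S S' c
      by (auto simp: by_row_def)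
    then have arr: "arrangement ?N (by_row S S') \<in> layered_pairings ?N \<and>
        ?f (arrangement ?N (by_row S S')) = (S, S')" if "(S, S') \<in> matched_starts k n" for S S'
      using that arrangement_layered[of "by_row S S'" ?N] by (auto simp: matched_starts_def)
    then show "\<forall>p\<in>matched_starts k n. ?f (?g p) = p"
      and "?g ` matched_starts k n \<subseteq> layered_pairings ?N"
      by auto
    show "?f ` layered_pairings ?N \<subseteq> matched_starts k n"
    proof
      fix p assume "p \<in> ?f ` layered_pairings ?N"
      then obtain M where M: "M \<in> layered_pairings ?N" "p = ?f M" by blast
      then have "M \<in> pairings (two_rows ?N)"
        by (simp add: layered_pairings_def)
      then show "p \<in> matched_starts k n"
        using M layered_arrangement(2)[OF M(1)] adjacent_starts_row_starts[of M ?N 0]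
          adjacent_starts_row_starts[of M ?N 1]
        by (simp add: matched_starts_def)
    qed
  qed
  then show ?thesis by (rule bij_betw_same_card)
qed

section \<open>Domino tilings of a rectangle with two rows\<close>

lemma uncovered_inj:
  assumes "S \<in> adjacent_starts m" "S' \<in> adjacent_starts m" "uncovered m S = uncovered m S'"
  shows "S = S'"
proof -
  \<comment> \<open>Reading from left to right, a covered point is a start exactly if it is not the
    successor of a start, and both sets cover the same points.\<close>
  have "i \<in> S \<longleftrightarrow> i \<in> S'" for i
  proof (induction i rule: less_induct)
    case (less i)
    have "S \<union> Suc ` S = S' \<union> Suc ` S'"
    proof -
      have "T \<union> Suc ` T \<subseteq> {..<m}" if "T \<in> adjacent_starts m" for T
        using that adjacent_starts_subset[OF that] by (auto simp: adjacent_starts_def)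
      then show ?thesis
        using assms unfolding uncovered_def by blast
    qed
    moreover have "Suc j \<notin> S" if "j \<in> S" for j
      using assms(1) that by (auto simp: adjacent_starts_def)
    moreover have "Suc j \<notin> S'" if "j \<in> S'" for j
      using assms(2) that by (auto simp: adjacent_starts_def)
    ultimately show ?case
      using less by blast
  qed
  then show ?thesis by blast
qed

lemma horizontal_domino_iff:
  "horizontal_domino {(c, i), (c', j)} \<longleftrightarrow> c = c' \<and> (j = Suc i \<or> i = Suc j)"
  unfolding horizontal_domino_def by (auto simp: doubleton_eq_iff)

lemma vertical_domino_iff:
  "vertical_domino {(c, i), (c', j)} \<longleftrightarrow> i = j \<and> (c' = Suc c \<or> c = Suc c')"
  unfolding vertical_domino_def by (auto simp: doubleton_eq_iff)

lemma rectangle_two_rows: "rectangle k = two_rows (\<lambda>_. k)"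
  by (simp add: rectangle_def two_rows_def)

text \<open>Horizontal dominoes join neighbours, and vertical dominoes stay in their column, so
  their ends are ordered alike in both rows.\<close>

lemma domino_tilings_layered:
  assumes "T \<in> domino_tilings k"
  shows "T \<in> layered_pairings (\<lambda>_. k)"
proof -
  have part: "partition_on (two_rows (\<lambda>_. k)) T"
    and dom: "\<And>D. D \<in> T \<Longrightarrow> horizontal_domino D \<or> vertical_domino D"
    using assms by (auto simp: domino_tilings_def rectangle_two_rows)
  have "card D = 2" if "D \<in> T" for D
    using dom[OF that] by (auto simp: horizontal_domino_def vertical_domino_def)
  moreover have "j = Suc i" if "{(c, i), (c, j)} \<in> T" "i < j" for c i j
    using dom[OF that(1)] that(2) by (auto simp: horizontal_domino_iff vertical_domino_iff)
  moreover have "i = j" if "{(0, i), (1, j)} \<in> T" for i j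
    using dom[OF that(1)] by (auto simp: horizontal_domino_iff vertical_domino_iff)
  ultimately show ?thesis
    unfolding layered_pairings_def pairings_def using part by blast
qed

definition tiling_of_starts :: "nat \<Rightarrow> nat set \<Rightarrow> (nat \<times> nat) set set" where
  "tiling_of_starts k S = arrangement (\<lambda>_. k) (\<lambda>_. S)"

text \<open>The vertical dominoes leave the same columns uncovered in both rows, and uncovered sets
  determine starts, so row 0 alone determines the tiling.\<close>

lemma tiling_of_starts_row_starts:
  assumes T: "T \<in> domino_tilings k"
  shows "T = tiling_of_starts k (row_starts T 0)"
proof -
  have L: "T \<in> layered_pairings (\<lambda>_. k)"
    using domino_tilings_layered[OF T] .
  then have P: "T \<in> pairings (two_rows (\<lambda>_. k))"
    by (simp add: layered_pairings_def)
  have eq: "i = j" if "{(0, i), (1, j)} \<in> T" for i j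
    using T that unfolding domino_tilings_def
    by (auto simp: horizontal_domino_iff vertical_domino_iff)
  have "i \<in> uncovered k (row_starts T 0) \<longleftrightarrow> i \<in> uncovered k (row_starts T 1)" for i
    using layered_cross_partner[OF L, of 0 i] layered_cross_partner[OF L, of 1 i] eq
    by (auto simp: insert_commute)
  then have "row_starts T 0 = row_starts T 1"
    using uncovered_inj adjacent_starts_row_starts[OF P] by blast
  then have "arrangement (\<lambda>_. k) (row_starts T) = tiling_of_starts k (row_starts T 0)"
    unfolding tiling_of_starts_def by (intro arrangement_cong) simp_all
  then show ?thesis
    using layered_arrangement(1)[OF L] by simp
qed

text \<open>Within one set equal ranks mean equal elements, so matching a row with its copy yields
  whole columns.\<close>

lemma tiling_of_starts_eq:
  "tiling_of_starts k S = {{(c, i), (c, Suc i)} | c i. c < 2 \<and> i \<in> S} \<union>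
     (\<lambda>i. {(0, i), (1, i)}) ` uncovered k S"
proof -
  have "i \<in> uncovered k S \<and> j \<in> uncovered k S \<and>
      rank_in (uncovered k S) i = rank_in (uncovered k S) j \<longleftrightarrow> i \<in> uncovered k S \<and> i = j" for i j
    using rank_in_inj[of "uncovered k S" i j] by auto
  then show ?thesis
    unfolding tiling_of_starts_def arrangement_def by auto
qed

lemma tiling_of_starts:
  assumes S: "S \<in> adjacent_starts k"
  shows "tiling_of_starts k S \<in> domino_tilings k"
    and "row_starts (tiling_of_starts k S) 0 = S"
    and "num_vertical (tiling_of_starts k S) = card (uncovered k S)"
proof -
  have "tiling_of_starts k S \<in> layered_pairings (\<lambda>_. k)"
    unfolding tiling_of_starts_def using S by (intro arrangement_layered(1)) auto
  then have "partition_on (rectangle k) (tiling_of_starts k S)"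
    by (simp add: layered_pairings_def pairings_def rectangle_two_rows)
  moreover have "\<forall>D\<in>tiling_of_starts k S. horizontal_domino D \<or> vertical_domino D"
    unfolding tiling_of_starts_eq by (auto simp: horizontal_domino_iff vertical_domino_iff)
  ultimately show "tiling_of_starts k S \<in> domino_tilings k"
    by (simp add: domino_tilings_def)
  show "row_starts (tiling_of_starts k S) 0 = S"
    unfolding tiling_of_starts_def using S by (intro arrangement_layered(2)) auto
  \<comment> \<open>Blocks inside a row are not vertical, which leaves one vertical domino for each
    uncovered column.\<close>
  have "{D \<in> tiling_of_starts k S. vertical_domino D} = (\<lambda>i. {(0, i), (1, i)}) ` uncovered k S"
    unfolding tiling_of_starts_eq by (auto simp: vertical_domino_iff)
  moreover have "inj_on (\<lambda>i::nat. {(0::nat, i), (1, i)}) (uncovered k S)"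
    by (auto simp: inj_on_def doubleton_eq_iff)
  ultimately show "num_vertical (tiling_of_starts k S) = card (uncovered k S)"
    by (simp add: num_vertical_def card_image)
qed

text \<open>The number of vertical dominoes is the number of uncovered columns, so equality of the
  former is the matching condition on the start sets.\<close>

lemma d_eq_card_matched_starts: "d k n = card (matched_starts k n)"
proof -
  let ?D = "{(T1, T2). T1 \<in> domino_tilings k \<and> T2 \<in> domino_tilings n \<and>
              num_vertical T1 = num_vertical T2}"
  have starts: "row_starts T 0 \<in> adjacent_starts m" if "T \<in> domino_tilings m" for T m
    using domino_tilings_layered[OF that] adjacent_starts_row_starts[of T "\<lambda>_. m" 0]
    by (simp add: layered_pairings_def)
  have "bij_betw (\<lambda>(S, S'). (tiling_of_starts k S, tiling_of_starts n S')) (matched_starts k n) ?D"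
  proof (rule bij_betw_byWitness[where f' = "\<lambda>(T1, T2). (row_starts T1 0, row_starts T2 0)"])
    show "\<forall>p\<in>?D. (\<lambda>(S, S'). (tiling_of_starts k S, tiling_of_starts n S'))
        ((\<lambda>(T1, T2). (row_starts T1 0, row_starts T2 0)) p) = p"
      using tiling_of_starts_row_starts by auto
    show "(\<lambda>(T1, T2). (row_starts T1 0, row_starts T2 0)) ` ?D \<subseteq> matched_starts k n"
    proof clarify
      fix T1 T2
      assume T: "T1 \<in> domino_tilings k" "T2 \<in> domino_tilings n" "num_vertical T1 = num_vertical T2"
      then have "card (uncovered k (row_starts T1 0)) = card (uncovered n (row_starts T2 0))"
        using tiling_of_starts(3)[OF starts] tiling_of_starts_row_starts by metis
      then show "(row_starts T1 0, row_starts T2 0) \<in> matched_starts k n"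
        using T starts by (simp add: matched_starts_def)
    qed
  qed (auto simp: matched_starts_def tiling_of_starts)
  then show ?thesis
    unfolding d_def by (simp add: bij_betw_same_card)
qed

section \<open>Transport of pairings along an injection\<close>

lemma pairings_image:
  assumes inj: "inj_on f X"
  shows "bij_betw ((`) ((`) f)) (pairings X) (pairings (f ` X))"
proof -
  define h where "h = inv_into X f"
  have hf: "h (f x) = x" if "x \<in> X" for x
    using inj that by (simp add: h_def)
  have fh: "f (h y) = y" "h y \<in> X" if "y \<in> f ` X" for y
    using that by (auto simp: h_def f_inv_into_f inv_into_into)
  \<comment> \<open>Stated for arbitrary \<open>g\<close> because it is applied both to
    \<open>f\<close> and to its inverse \<open>h\<close>.\<close>
  have into: "(`) g ` M \<in> pairings (g ` Y)" if g: "inj_on g Y" and M: "M \<in> pairings Y"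
    for g :: "'c \<Rightarrow> 'd" and Y M
  proof (rule pairingsI)
    fix e assume "e \<in> (`) g ` M"
    then obtain e' where e': "e' \<in> M" "e = g ` e'" by blast
    show "e \<subseteq> g ` Y \<and> card e = 2"
      using pairings_block[OF M e'(1)] e'(2) inj_on_subset[OF g] by (auto simp: card_image)
  next
    fix x assume "x \<in> g ` Y"
    then show "\<exists>e\<in>(`) g ` M. x \<in> e"
      using M unfolding pairings_def partition_on_def by blast
  next
    fix e1 e2 x assume e: "e1 \<in> (`) g ` M" "e2 \<in> (`) g ` M" "x \<in> e1" "x \<in> e2"
    then obtain d1 d2 y1 y2 where d: "d1 \<in> M" "e1 = g ` d1" "d2 \<in> M" "e2 = g ` d2"
      "y1 \<in> d1" "y2 \<in> d2" "x = g y1" "x = g y2" by blast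
    then have "y1 = y2"
      using pairings_block(1)[OF M] g unfolding inj_on_def by (metis subsetD)
    then show "e1 = e2"
      using pairings_unique[OF M, of d1 d2 y1] d by simp
  qed
  have sub: "e \<subseteq> Y" if "e \<in> M" "M \<in> pairings Y" for e M and Y :: "'c set"
    using pairings_block(1) that by blast
  show ?thesis
  proof (rule bij_betw_byWitness[where f' = "(`) ((`) h)"])
    show "\<forall>M\<in>pairings X. (`) h ` (`) f ` M = M"
    proof
      fix M assume "M \<in> pairings X"
      then have "h ` f ` e = e" if "e \<in> M" for e
        using sub[OF that] hf by (force simp: image_image)
      then show "(`) h ` (`) f ` M = M"
        by (simp add: image_image)
    qed
    show "\<forall>M\<in>pairings (f ` X). (`) f ` (`) h ` M = M"
    proof
      fix M assume "M \<in> pairings (f ` X)"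
      then have "f ` h ` e = e" if "e \<in> M" for e
        using sub[OF that] fh by (force simp: image_image)
      then show "(`) f ` (`) h ` M = M"
        by (simp add: image_image)
    qed
    show "(`) ((`) f) ` pairings X \<subseteq> pairings (f ` X)"
      using into[OF inj] by blast
    have "inj_on h (f ` X)" "h ` f ` X = X"
      using hf by (auto simp: inj_on_def image_iff)
    then show "(`) ((`) h) ` pairings (f ` X) \<subseteq> pairings X"
      using into[of h "f ` X"] by auto
  qed
qed

section \<open>Affine coordinates for two parallel lines\<close>

lemma noncrossing_iff:
  assumes "M \<in> pairings X"
  shows "noncrossing M \<longleftrightarrow>
    (\<forall>e\<in>M. \<forall>e'\<in>M. e \<noteq> e' \<longrightarrow> convex hull e \<inter> convex hull e' = {})"
proof
  assume R: "noncrossing M"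
  show "\<forall>e\<in>M. \<forall>e'\<in>M. e \<noteq> e' \<longrightarrow> convex hull e \<inter> convex hull e' = {}"
  proof (intro ballI impI)
    fix e e' assume e: "e \<in> M" "e' \<in> M" "e \<noteq> e'"
    \<comment> \<open>\<open>noncrossing\<close> names endpoints whereas blocks are sets; having two
      elements, the blocks supply the endpoints.\<close>
    obtain x y u v where "e = {x, y}" "e' = {u, v}"
      using pairings_block(2)[OF assms] e by (meson card_2_iff)
    then show "convex hull e \<inter> convex hull e' = {}"
      using R e unfolding noncrossing_def segment_convex_hull by blast
  qed
qed (simp add: noncrossing_def segment_convex_hull)

text \<open>Affine coordinates with origin \<open>p\<close> and axes \<open>w\<close> and
  \<open>v\<close>; the two marked lines become \<open>y = 0\<close> and
  \<open>y = 1\<close>.\<close>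

definition plane :: "'a::real_vector \<Rightarrow> 'a \<Rightarrow> 'a \<Rightarrow> real \<times> real \<Rightarrow> 'a" where
  "plane p w v = (\<lambda>(x, y). p + (x *\<^sub>R w + y *\<^sub>R v))"

text \<open>The map is linear up to a translation, and both kinds of map commute with convex
  hulls.\<close>

lemma convex_hull_plane: "convex hull (plane p w v ` S) = plane p w v ` (convex hull S)"
proof -
  define g where "g = (\<lambda>(x, y). x *\<^sub>R w + y *\<^sub>R v)"
  have "linear g"
    by (rule linearI) (auto simp: g_def algebra_simps)
  moreover have "plane p w v ` S = (\<lambda>x. p + x) ` g ` S" for S
    by (auto simp: plane_def g_def image_image split_def)
  ultimately show ?thesis
    by (simp add: convex_hull_translation convex_hull_linear_image)
qed

text \<open>An affine basis consists of two points, whose difference serves as direction.\<close>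

lemma affine_aff_dim_1E:
  fixes L :: "'a::euclidean_space set"
  assumes "affine L" "aff_dim L = 1"
  obtains p w where "w \<noteq> 0" "L = range (\<lambda>x. p + x *\<^sub>R w)"
proof -
  obtain B where B: "affine hull B = affine hull L" "of_nat (card B) = aff_dim L + 1"
    using aff_dim_basis_exists[of L] by blast
  then have "card B = 2" using assms by simp
  then obtain p q where pq: "B = {p, q}" "p \<noteq> q"
    by (meson card_2_iff)
  have "L = affine hull {p, q}"
    using B(1) pq assms(1) by (metis affine_hull_eq)
  also have "\<dots> = range (\<lambda>x. p + x *\<^sub>R (q - p))"
  proof (intro equalityI subsetI)
    fix z assume "z \<in> affine hull {p, q}"
    then obtain a b where "z = a *\<^sub>R p + b *\<^sub>R q" "a + b = 1"
      by (auto simp: affine_hull_2)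
    then have "z = p + b *\<^sub>R (q - p)"
      by (simp add: algebra_simps flip: scaleR_add_left)
    then show "z \<in> range (\<lambda>x. p + x *\<^sub>R (q - p))" by blast
  next
    fix z assume "z \<in> range (\<lambda>x. p + x *\<^sub>R (q - p))"
    then obtain x where "z = p + x *\<^sub>R (q - p)" by blast
    then have "z = (1 - x) *\<^sub>R p + x *\<^sub>R q" by (simp add: algebra_simps)
    then show "z \<in> affine hull {p, q}"
      unfolding affine_hull_2 by (intro CollectI exI[of _ "1 - x"] exI[of _ x]) simp
  qed
  finally show ?thesis
    using that[of "q - p" p] pq(2) by simp
qed

lemma finite_real_enumeration:
  fixes T :: "real set"
  assumes "finite T"
  obtains t where "T = t ` {..<card T}" "\<And>i j. i < j \<Longrightarrow> j < card T \<Longrightarrow> t i < t j"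
proof -
  let ?xs = "sorted_list_of_set T"
  have len: "length ?xs = card T"
    by simp
  have "T = set ?xs"
    using assms by simp
  also have "\<dots> = (!) ?xs ` {..<card T}"
    by (simp add: set_conv_nth image_def Bex_def) auto
  finally have "T = (!) ?xs ` {..<card T}" .
  moreover have "?xs ! i < ?xs ! j" if "i < j" "j < card T" for i j
    using that sorted_wrt_nth_less[OF strict_sorted_list_of_set] len by metis
  ultimately show ?thesis
    using that[of "(!) ?xs"] by blast
qed

text \<open>The row number doubles as the height, in accordance with the heights 0 and 1 of the two
  lines.\<close>

definition row_point :: "(nat \<Rightarrow> nat \<Rightarrow> real) \<Rightarrow> nat \<times> nat \<Rightarrow> real \<times> real" where
  "row_point t = (\<lambda>(c, i). (t c i, real c))"

text \<open>The direction of \<open>L\<close> and a translation from \<open>L\<close> to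
  \<open>L'\<close> serve as axes; sorting abscissae numbers the marked points of each line.\<close>

lemma two_line_coordinates:
  assumes "two_line_configuration k n A B"
  obtains p w v t where "inj (plane p w v)"
    "A \<union> B = (plane p w v \<circ> row_point t) ` two_rows (by_row k n)"
    "\<And>c i j. c < 2 \<Longrightarrow> i < j \<Longrightarrow> j < by_row k n c \<Longrightarrow> t c i < t c j"
proof -
  obtain L L' where L: "is_line L" "affine_parallel L L'" "L \<noteq> L'" "A \<subseteq> L" "B \<subseteq> L'"
    and fin: "finite A" "card A = k" "finite B" "card B = n"
    using assms unfolding two_line_configuration_def by blast
  obtain p w where w: "w \<noteq> 0" and Lp: "L = range (\<lambda>x. p + x *\<^sub>R w)"
    using L(1) affine_aff_dim_1E[of L] unfolding is_line_def by blast
  obtain v where v: "L' = (\<lambda>x. v + x) ` L"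
    using L(2) unfolding affine_parallel_def by blast
  have L0: "L = range (\<lambda>x. plane p w v (x, 0))"
    unfolding Lp by (simp add: plane_def)
  have L1: "L' = range (\<lambda>x. plane p w v (x, 1))"
    unfolding v Lp by (simp add: plane_def image_image algebra_simps)
  \<comment> \<open>A translation along \<open>w\<close> would map \<open>L\<close> onto itself,
    contrary to \<open>L \<noteq> L'\<close>; so the axes are independent.\<close>
  have v_notin: "v \<noteq> x *\<^sub>R w" for x
  proof
    assume "v = x *\<^sub>R w"
    then have shift: "plane p w v (y, 1) = plane p w v (y + x, 0)" for y
      using \<open>v = x *\<^sub>R w\<close> by (simp add: plane_def algebra_simps)
    have "L' \<subseteq> L"
      using shift by (auto simp: L0 L1)
    moreover have "plane p w v (y, 0) \<in> L'" for y
      unfolding L1 by (rule image_eqI[of _ _ "y - x"]) (simp_all add: shift)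
    then have "L \<subseteq> L'"
      unfolding L0 by blast
    ultimately show False
      using L(3) by blast
  qed
  have inj: "inj (plane p w v)"
  proof (rule injI, clarify)
    fix x y x' y' assume "plane p w v (x, y) = plane p w v (x', y')"
    then have e: "(y - y') *\<^sub>R v = (x' - x) *\<^sub>R w"
      by (simp add: plane_def algebra_simps)
    have "y = y'"
    proof (rule ccontr)
      assume "y \<noteq> y'"
      then have "v = (1 / (y - y')) *\<^sub>R ((y - y') *\<^sub>R v)" by simp
      also have "\<dots> = ((x' - x) / (y - y')) *\<^sub>R w" unfolding e by simp
      finally show False using v_notin by blast
    qed
    then show "x = x' \<and> y = y'" using e w by simp
  qed
  \<comment> \<open>A set of points at height \<open>y\<close> is pulled back to its abscissae,
    which are then sorted.\<close>
  have enum: "\<exists>t. S = (\<lambda>i. plane p w v (t i, y)) ` {..<card S} \<and>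
      (\<forall>i j. i < j \<longrightarrow> j < card S \<longrightarrow> t i < t j)"
    if S: "finite S" "S \<subseteq> range (\<lambda>x. plane p w v (x, y))" for S y
  proof -
    define f where "f = (\<lambda>x. plane p w v (x, y))"
    have f: "inj f" using inj by (auto simp: inj_def f_def)
    have S_eq: "f ` (f -` S) = S"
      using S(2) by (auto simp: f_def)
    have "finite (f -` S)"
      using finite_vimageI[OF S(1) f] .
    then obtain t where t: "f -` S = t ` {..<card (f -` S)}"
        "\<And>i j. i < j \<Longrightarrow> j < card (f -` S) \<Longrightarrow> t i < t j"
      by (rule finite_real_enumeration) blast
    have card: "card (f -` S) = card S"
      using card_image[OF inj_on_subset[OF f subset_UNIV], of "f -` S"] unfolding S_eq by simp
    note t = t[unfolded card]
    have "S = (\<lambda>i. f (t i)) ` {..<card S}"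
      using S_eq[symmetric] unfolding t(1) image_image .
    then show ?thesis
      using t(2) unfolding f_def by (intro exI[of _ t] conjI allI impI)
  qed
  obtain t0 where t0: "A = (\<lambda>i. plane p w v (t0 i, 0)) ` {..<k}"
      "\<And>i j. i < j \<Longrightarrow> j < k \<Longrightarrow> t0 i < t0 j"
    using enum[OF fin(1) L(4)[unfolded L0], unfolded fin] by (elim exE conjE) (rule that, auto)
  obtain t1 where t1: "B = (\<lambda>i. plane p w v (t1 i, 1)) ` {..<n}"
      "\<And>i j. i < j \<Longrightarrow> j < n \<Longrightarrow> t1 i < t1 j"
    using enum[OF fin(3) L(5)[unfolded L1], unfolded fin] by (elim exE conjE) (rule that, auto)
  have "two_rows (by_row k n) = Pair 0 ` {..<k} \<union> Pair 1 ` {..<n}"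
    by (auto simp: two_rows_def less_2_cases_iff)
  then have "(plane p w v \<circ> row_point (by_row t0 t1)) ` two_rows (by_row k n) = A \<union> B"
    unfolding t0(1) t1(1) by (simp add: image_Un image_image row_point_def)
  moreover have "by_row t0 t1 c i < by_row t0 t1 c j"
    if "c < 2" "i < j" "j < by_row k n c" for c i j
    using that t0(2) t1(2) by (auto simp: less_2_cases_iff)
  ultimately show ?thesis
    using that[OF inj, of "by_row t0 t1"] by simp
qed

section \<open>Disjointness of segments in coordinates\<close>

lemma convex_hull_doubleton_coords:
  fixes x y x' y' :: real
  shows "z \<in> convex hull {(x, y), (x', y')} \<longleftrightarrow>
    (\<exists>u. 0 \<le> u \<and> u \<le> 1 \<and> z = ((1 - u) * x + u * x', (1 - u) * y + u * y'))"
  unfolding segment_convex_hull[symmetric] in_segment by simp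

lemma convex_hull_doubleton_horizontal:
  fixes x x' y :: real
  assumes "x \<le> x'"
  shows "convex hull {(x, y), (x', y)} = {x..x'} \<times> {y}"
proof (intro equalityI subsetI)
  fix z assume "z \<in> convex hull {(x, y), (x', y)}"
  then obtain u where u: "0 \<le> u" "u \<le> 1" "z = ((1 - u) * x + u * x', y)"
    unfolding convex_hull_doubleton_coords by (auto simp: algebra_simps)
  \<comment> \<open>The first form bounds the abscissa below by \<open>x\<close>, the second bounds
    it above by \<open>x'\<close>.\<close>
  have "(1 - u) * x + u * x' = x + u * (x' - x)" "(1 - u) * x + u * x' = x' - (1 - u) * (x' - x)"
    by (auto simp: algebra_simps)
  moreover have "0 \<le> u * (x' - x)" "0 \<le> (1 - u) * (x' - x)"
    using u assms by auto
  ultimately show "z \<in> {x..x'} \<times> {y}"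
    using u(3) by auto
next
  fix z assume "z \<in> {x..x'} \<times> {y}"
  then obtain a where a: "z = (a, y)" "x \<le> a" "a \<le> x'" by auto
  have "a \<in> closed_segment x x'"
    using a assms by (simp add: closed_segment_eq_real_ivl)
  then obtain u where "0 \<le> u" "u \<le> 1" "a = (1 - u) * x + u * x'"
    by (auto simp: in_segment)
  then show "z \<in> convex hull {(x, y), (x', y)}"
    unfolding convex_hull_doubleton_coords a by (intro exI[of _ u]) (simp add: algebra_simps)
qed

text \<open>At height \<open>u\<close> the second segment lies
  \<open>(1 - u) * (x' - x) + u * (s' - s)\<close> to the right of the first. This is affine in
  \<open>u\<close> and positive at 0, so it has a zero up to height 1 exactly if its final value
  \<open>s' - s\<close>, which is nonzero, is negative.\<close>

lemma convex_hull_transversals_disjoint_iff: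
  fixes x x' s s' :: real
  assumes "x < x'" "s \<noteq> s'"
  shows "convex hull {(x, 0::real), (s, 1)} \<inter> convex hull {(x', 0), (s', 1)} = {} \<longleftrightarrow> s < s'"
proof
  assume disj: "convex hull {(x, 0::real), (s, 1)} \<inter> convex hull {(x', 0), (s', 1)} = {}"
  show "s < s'"
  proof (rule ccontr)
    assume "\<not> s < s'"
    then have s: "s' < s" using assms(2) by simp
    \<comment> \<open>The height at which the horizontal distance of the two segments
      vanishes.\<close>
    define u where "u = (x' - x) / ((x' - x) + (s - s'))"
    have D: "(x' - x) + (s - s') > 0" using assms(1) s by simp
    have u: "0 \<le> u" "u \<le> 1"
      using D assms(1) s by (auto simp: u_def divide_simps)
    have "u * ((x' - x) + (s - s')) = x' - x"
      using D by (simp add: u_def)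
    then have eq: "(1 - u) * x + u * s = (1 - u) * x' + u * s'"
      by (simp add: algebra_simps)
    have "((1 - u) * x + u * s, u) \<in> convex hull {(x, 0), (s, 1)}"
      unfolding convex_hull_doubleton_coords using u by (intro exI[of _ u]) simp
    moreover have "((1 - u) * x' + u * s', u) \<in> convex hull {(x', 0), (s', 1)}"
      unfolding convex_hull_doubleton_coords using u by (intro exI[of _ u]) simp
    ultimately show False using disj unfolding eq by (meson disjoint_iff)
  qed
next
  assume s: "s < s'"
  show "convex hull {(x, 0::real), (s, 1)} \<inter> convex hull {(x', 0), (s', 1)} = {}"
  proof (rule ccontr)
    assume "\<not> ?thesis"
    then obtain z where "z \<in> convex hull {(x, 0::real), (s, 1)}" "z \<in> convex hull {(x', 0), (s', 1)}"
      by (meson disjoint_iff)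
    then obtain u where u: "0 \<le> u" "u \<le> 1" "(1 - u) * x + u * s = (1 - u) * x' + u * s'"
      unfolding convex_hull_doubleton_coords by auto
    then have "(1 - u) * (x' - x) + u * (s' - s) = 0"
      by (simp add: algebra_simps)
    moreover have "0 \<le> (1 - u) * (x' - x)" "0 \<le> u * (s' - s)"
      using u assms s by auto
    ultimately have "(1 - u) * (x' - x) = 0" "u * (s' - s) = 0"
      by linarith+
    then show False using assms s by simp
  qed
qed

text \<open>The height equals the segment parameter, so heights 0 and 1 are reached only at the
  endpoints.\<close>

lemma convex_hull_transversal_meets_row:
  fixes x s a y :: real
  assumes "(a, y) \<in> convex hull {(x, 0), (s, 1)}"
  shows "y = 0 \<Longrightarrow> a = x" "y = 1 \<Longrightarrow> a = s"
  using assms by (auto simp: convex_hull_doubleton_coords)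

text \<open>In a layered pairing any two blocks are separated by height or by the order of
  abscissae. Conversely, a skipped point lies on the segment that skips it, and transversals in the
  wrong order intersect.\<close>

lemma layered_iff_disjoint_hulls:
  assumes t: "\<And>c i j. c < 2 \<Longrightarrow> i < j \<Longrightarrow> j < N c \<Longrightarrow> t c i < t c j"
    and M: "M \<in> pairings (two_rows N)"
  shows "M \<in> layered_pairings N \<longleftrightarrow>
    (\<forall>e\<in>M. \<forall>e'\<in>M. e \<noteq> e' \<longrightarrow> convex hull (row_point t ` e) \<inter> convex hull (row_point t ` e') = {})"
    (is "_ \<longleftrightarrow> ?disjoint")
proof
  have in_rows: "c < 2" "i < N c" if "(c, i) \<in> e" "e \<in> M" for c i e
    using pairings_block(1)[OF M that(2)] that(1) by (auto simp: two_rows_def)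
  assume L: "M \<in> layered_pairings N"
  have blocks: "(\<exists>c i. e = {(c, i), (c, Suc i)} \<and> c < 2 \<and> Suc i < N c) \<or>
      (\<exists>i j. e = {(0, i), (1, j)} \<and> i < N 0 \<and> j < N 1)" if e: "e \<in> M" for e
  proof -
    have "e \<in> arrangement N (row_starts M)"
      using layered_arrangement(1)[OF L] e by simp
    then show ?thesis
      unfolding arrangement_def using adjacent_starts_row_starts[OF M]
      by (fastforce simp: adjacent_starts_def uncovered_def)
  qed
  have row: "convex hull (row_point t ` {(c, i), (c, Suc i)}) = {t c i..t c (Suc i)} \<times> {real c}"
    if "c < 2" "Suc i < N c" for c i
    using t[OF that(1) _ that(2), of i] by (simp add: row_point_def convex_hull_doubleton_horizontal)
  have cross: "row_point t ` {(0, i), (1, j)} = {(t 0 i, 0), (t 1 j, 1)}" for i j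
    by (simp add: row_point_def)
  \<comment> \<open>Strict monotonicity keeps all other marked points of the row out of the interval
    between two neighbours, so a transversal ending at another point misses that interval.\<close>
  have tm: "t c j \<notin> {t c i..t c (Suc i)}"
    if "c < 2" "Suc i < N c" "j < N c" "j \<noteq> i" "j \<noteq> Suc i" for c i j
  proof (cases "j < i")
    case True
    then show ?thesis using t[of c j i] that by auto
  next
    case False
    then show ?thesis using t[of c "Suc i" j] that by auto
  qed
  have row_cross: "convex hull (row_point t ` {(c, i), (c, Suc i)}) \<inter>
      convex hull (row_point t ` {(0, i'), (1, j')}) = {}"
    if "c < 2" "Suc i < N c" "i' < N 0" "j' < N 1"
      "{(c, i), (c, Suc i)} \<inter> {(0, i'), (1, j')} = {}" for c i i' j'
  proof (rule ccontr)
    assume "\<not> ?thesis"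
    then have "({t c i..t c (Suc i)} \<times> {real c}) \<inter> convex hull {(t 0 i', 0), (t 1 j', 1)} \<noteq> {}"
      unfolding row[OF that(1,2)] cross .
    then obtain a where a: "a \<in> {t c i..t c (Suc i)}"
      "(a, real c) \<in> convex hull {(t 0 i', 0), (t 1 j', 1)}"
      by blast
    have "c = 0 \<or> c = 1" using that(1) by linarith
    then show False
    proof
      assume "c = 0"
      then show False
        using a convex_hull_transversal_meets_row(1)[OF a(2)] tm[of 0 i i'] that by auto
    next
      assume "c = 1"
      then show False
        using a convex_hull_transversal_meets_row(2)[OF a(2)] tm[of 1 i j'] that by auto
    qed
  qed
  have row_row: "convex hull (row_point t ` {(c, i), (c, Suc i)}) \<inter>
      convex hull (row_point t ` {(c', i'), (c', Suc i')}) = {}"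
    if "c < 2" "Suc i < N c" "c' < 2" "Suc i' < N c'"
      "{(c, i), (c, Suc i)} \<inter> {(c', i'), (c', Suc i')} = {}" for c i c' i'
  proof (cases "c = c'")
    case True
    then have "Suc i < i' \<or> Suc i' < i" using that(5) by auto
    then have "t c (Suc i) < t c i' \<or> t c (Suc i') < t c i"
      using t[of c "Suc i" i'] t[of c "Suc i'" i] that True by auto
    then show ?thesis
      unfolding row[OF that(1,2)] row[OF that(3,4)] using True by auto
  next
    case False
    then show ?thesis
      unfolding row[OF that(1,2)] row[OF that(3,4)] by auto
  qed
  have cross_cross: "convex hull (row_point t ` {(0, i), (1, j)}) \<inter>
      convex hull (row_point t ` {(0, i'), (1, j')}) = {}"
    if "{(0, i), (1, j)} \<in> M" "{(0, i'), (1, j')} \<in> M" "i < i'" for i j i' j'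
  proof -
    have "j < j'"
      using L that unfolding layered_pairings_def by blast
    then have "t 0 i < t 0 i'" "t 1 j < t 1 j'"
      using t[of 0 i i'] t[of 1 j j'] that(3) in_rows(2)[OF _ that(2)] by auto
    then show ?thesis
      unfolding cross by (subst convex_hull_transversals_disjoint_iff) auto
  qed
  show ?disjoint
  proof (intro ballI impI)
    fix e e' assume e: "e \<in> M" "e' \<in> M" "e \<noteq> e'"
    then have disj: "e \<inter> e' = {}"
      using pairings_unique[OF M] by blast
    show "convex hull (row_point t ` e) \<inter> convex hull (row_point t ` e') = {}"
      using blocks[OF e(1)] blocks[OF e(2)]
    proof (elim disjE exE conjE)
      fix c i c' i'
      assume "e = {(c, i), (c, Suc i)}" "c < 2" "Suc i < N c"
        "e' = {(c', i'), (c', Suc i')}" "c' < 2" "Suc i' < N c'"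
      then show ?thesis using row_row disj by simp
    next
      fix c i i' j'
      assume "e = {(c, i), (c, Suc i)}" "c < 2" "Suc i < N c"
        "e' = {(0, i'), (1, j')}" "i' < N 0" "j' < N 1"
      then show ?thesis using row_cross[of c i i' j'] disj by simp
    next
      fix c i i' j'
      assume "e' = {(c, i), (c, Suc i)}" "c < 2" "Suc i < N c"
        "e = {(0, i'), (1, j')}" "i' < N 0" "j' < N 1"
      then show ?thesis using row_cross[of c i i' j'] disj by (simp add: Int_commute)
    next
      fix i j i' j'
      assume a: "e = {(0, i), (1, j)}" "e' = {(0, i'), (1, j')}"
      then have "i < i' \<or> i' < i" using disj by auto
      then show ?thesis
        using cross_cross[of i j i' j'] cross_cross[of i' j' i j] e a by (auto simp: Int_commute)
    qed
  qed
next
  have in_rows: "c < 2" "i < N c" if "(c, i) \<in> e" "e \<in> M" for c i e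
    using pairings_block(1)[OF M that(2)] that(1) by (auto simp: two_rows_def)
  assume D: ?disjoint
  have "j = Suc i" if e: "{(c, i), (c, j)} \<in> M" and "i < j" for c i j
  proof (rule ccontr)
    assume "j \<noteq> Suc i"
    \<comment> \<open>The point \<open>Suc i\<close> lies between the two ends, so the block
      containing it is a different one that meets this segment.\<close>
    then have m: "i < Suc i" "Suc i < j" using \<open>i < j\<close> by auto
    have c: "c < 2" "j < N c" using in_rows[OF _ e] by auto
    then have "(c, Suc i) \<in> two_rows N" using m by (simp add: two_rows_def)
    then obtain y where y: "{(c, Suc i), y} \<in> M"
      using pairings_partner[OF M] by blast
    have "t c i \<le> t c (Suc i)" "t c (Suc i) \<le> t c j" "t c i \<le> t c j"
      using t[of c i "Suc i"] t[of c "Suc i" j] m c by auto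
    then have "row_point t (c, Suc i) \<in> convex hull (row_point t ` {(c, i), (c, j)})"
      by (simp add: row_point_def convex_hull_doubleton_horizontal)
    moreover have "row_point t (c, Suc i) \<in> convex hull (row_point t ` {(c, Suc i), y})"
      by (rule hull_inc) simp
    moreover have "(c, Suc i) \<notin> {(c, i), (c, j)}" using m by auto
    then have "{(c, i), (c, j)} \<noteq> {(c, Suc i), y}" by (metis insertI1)
    then have "convex hull (row_point t ` {(c, i), (c, j)}) \<inter>
        convex hull (row_point t ` {(c, Suc i), y}) = {}"
      by (rule D[rule_format, OF e y])
    ultimately show False by (meson disjoint_iff)
  qed
  moreover have "j < j'"
    if e: "{(0, i), (1, j)} \<in> M" "{(0, i'), (1, j')} \<in> M" and "i < i'" for i j i' j'
  proof -
    have ne: "{(0, i), (1, j)} \<noteq> {(0::nat, i'), (1::nat, j')}"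
      using \<open>i < i'\<close> by (auto simp: doubleton_eq_iff)
    \<comment> \<open>The crossing criterion requires distinct ends in row 1, which uniqueness of
      partners provides.\<close>
    have "j \<noteq> j'"
    proof
      assume "j = j'"
      then have "{(1, j), (0, i)} \<in> M" "{(1, j), (0, i')} \<in> M"
        using e by (simp_all add: insert_commute)
      from pairings_partner_unique[OF M this] show False
        using \<open>i < i'\<close> by simp
    qed
    have rows: "i' < N 0" "j < N 1" "j' < N 1"
      using in_rows[OF _ e(1)] in_rows[OF _ e(2)] by auto
    have "t 0 i < t 0 i'" using t[of 0 i i'] rows \<open>i < i'\<close> by simp
    moreover have "t 1 j \<noteq> t 1 j'"
      using \<open>j \<noteq> j'\<close> t[of 1 j j'] t[of 1 j' j] rows by (cases j j' rule: linorder_cases) auto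
    moreover have "convex hull (row_point t ` {(0, i), (1, j)}) \<inter>
        convex hull (row_point t ` {(0, i'), (1, j')}) = {}"
      by (rule D[rule_format, OF e ne])
    then have "convex hull {(t 0 i, 0::real), (t 1 j, 1)} \<inter> convex hull {(t 0 i', 0), (t 1 j', 1)} = {}"
      by (simp add: row_point_def)
    ultimately have "t 1 j < t 1 j'"
      by (simp add: convex_hull_transversals_disjoint_iff)
    then show "j < j'"
      using \<open>j \<noteq> j'\<close> t[of 1 j' j] rows by (cases j j' rule: linorder_cases) auto
  qed
  ultimately show "M \<in> layered_pairings N"
    using M unfolding layered_pairings_def by blast
qed

text \<open>In affine coordinates the non-crossing pairings of the marked points correspond to the
  layered pairings of two rows, and these are as numerous as \<open>matched_starts k n\<close>,
  whose cardinality is also \<open>d k n\<close>.\<close>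

theorem theorem2:
  fixes k n :: nat and A B :: "(real^2) set"
  assumes "two_line_configuration k n A B"
  shows "d k n = num_noncrossing_pairings A B"
proof -
  let ?N = "by_row k n"
  obtain p w v t where inj: "inj (plane p w v)"
    and AB: "A \<union> B = (plane p w v \<circ> row_point t) ` two_rows ?N"
    and t: "\<And>c i j. c < 2 \<Longrightarrow> i < j \<Longrightarrow> j < ?N c \<Longrightarrow> t c i < t c j"
    using two_line_coordinates[OF assms] by blast
  define f where "f = plane p w v \<circ> row_point t"
  have t_inj: "i = j" if "c < 2" "i < ?N c" "j < ?N c" "t c i = t c j" for c i j
    using t[of c i j] t[of c j i] that by (cases i j rule: linorder_cases) auto
  have "inj_on (row_point t) (two_rows ?N)"
    by (auto simp: inj_on_def row_point_def two_rows_def t_inj)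
  then have f: "inj_on f (two_rows ?N)"
    unfolding f_def by (intro comp_inj_on inj_on_subset[OF inj]) auto
  have bij: "bij_betw ((`) ((`) f)) (pairings (two_rows ?N)) (pairings (A \<union> B))"
    using pairings_image[OF f] AB by (simp add: f_def)
  \<comment> \<open>The injective affine map commutes with hulls and with intersections, so
    disjointness can be tested in coordinates.\<close>
  have hull: "convex hull (f ` e) \<inter> convex hull (f ` e') = {} \<longleftrightarrow>
      convex hull (row_point t ` e) \<inter> convex hull (row_point t ` e') = {}" for e e'
    unfolding f_def image_comp[symmetric] convex_hull_plane image_Int[OF inj, symmetric] by simp
  have noncrossing: "noncrossing ((`) f ` M) \<longleftrightarrow> M \<in> layered_pairings ?N"
    if M: "M \<in> pairings (two_rows ?N)" for M
  proof -
    have "(`) f ` M \<in> pairings (A \<union> B)"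
      using bij_betwE[OF bij] M by blast
    \<comment> \<open>Only distinct blocks are compared, so \<open>f\<close> has to keep distinct
      blocks distinct.\<close>
    moreover have "f ` e = f ` e' \<longleftrightarrow> e = e'" if "e \<in> M" "e' \<in> M" for e e'
      using inj_on_image_eq_iff[OF f pairings_block(1)[OF M that(1)] pairings_block(1)[OF M that(2)]] .
    ultimately show ?thesis
      by (simp add: layered_iff_disjoint_hulls[OF t M] noncrossing_iff hull)
  qed
  have "layered_pairings ?N = {M \<in> pairings (two_rows ?N). noncrossing ((`) f ` M)}"
    using noncrossing layered_pairings_def by auto
  then have "(`) ((`) f) ` layered_pairings ?N = {M \<in> (`) ((`) f) ` pairings (two_rows ?N). noncrossing M}"
    by auto
  also have "(`) ((`) f) ` pairings (two_rows ?N) = pairings (A \<union> B)"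
    using bij by (rule bij_betw_imp_surj_on)
  finally have "bij_betw ((`) ((`) f)) (layered_pairings ?N) {M \<in> pairings (A \<union> B). noncrossing M}"
    by (intro bij_betw_subset[OF bij]) (auto simp: layered_pairings_def)
  then have "card (layered_pairings ?N) = num_noncrossing_pairings A B"
    unfolding num_noncrossing_pairings_def by (rule bij_betw_same_card)
  then show ?thesis
    by (simp add: d_eq_card_matched_starts card_layered_pairings)
qed

end
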